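(* Let $d\ge 1$ be a finite integer, let $f\ge 0$ be an integer, and let $G(\mathcal{V},\mathcal{E})$ be a simple directed graph without self-loops on $n=|\mathcal{V}|\ge 2$ processes. If the Byzantine vector consensus problem (with $d$-dimensional inputs and up to $f$ Byzantine faulty processes) can be solved using an iterative algorithm in $G(\mathcal{V},\mathcal{E})$, then $G(\mathcal{V},\mathcal{E})$ satisfies the following condition (Condition NC): for any partition $V_0,V_1,\dots,V_p,C,F$ of $\mathcal{V}$, where $1\le p\le d$, $V_k\neq\emptyset$ for $0\le k\le p$, and $|F|\le f$, there exist $i,j$ ($0\le i,j\le p$, $i\ne j$) such that some process in $V_j$ has at least $f+1$ incoming edges from processes in $V_i\cup C$.
   Context: System model. The system is synchronous. $\mathcal{V}=\{1,\dots,n\}$ is the set of processes. Process $i$ can reliably transmit messages to process $j\ne i$ if and only if the directed edge $(i,j)$ is in $\mathcal{E}$; each process can also send messages to itself, although self-loops are excluded from $\mathcal{E}$. $N_i^-=\{j : (j,i)\in\mathcal{E}\}$ and $N_i^+=\{j:(i,j)\in\mathcal{E}\}$ are the sets of incoming and outgoing neighbors of $i$. Up to $f$ processes may be Byzantine faulty: a faulty process may misbehave arbitrarily, faulty processes may collaborate, and they have complete knowledge of the execution (states of all processes, message contents, the algorithm specification, the network topology). In a partition as in Condition NC, the sets $C$ and $F$ may be empty. Byzantine vector consensus. The input at each process is a $d$-dimensional real vector (a point of $\mathbf{R}^d$). Each element of the input vector at each fault-free process is assumed to be lower bounded by a constant $\mu$ and upper bounded by a constant $U$, both known a priori; $\epsilon>0$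 is a pre-defined constant. An algorithm solves the problem if it satisfies the following conditions in the presence of up to $f$ Byzantine faulty processes: (Termination) each fault-free process terminates after a finite number of iterations (the number of iterations may be a function of $\mu$ and $U$); (Validity) the state of each fault-free process at the end of each iteration is in the convex hull of the $d$-dimensional input vectors at the fault-free processes; ($\epsilon$-Agreement) when the algorithm terminates, for each $1\le l\le d$, the $l$-th elements of the decision vectors at any two fault-free processes are within $\epsilon$ of each other. Any information carried over by a process from one iteration to the next is considered part of its state. Iterative algorithm. Each process $i$ maintains a state $\mathbf{v}_i$, a $d$-dimensional vector; $\mathbf{v}_i[0]$ equals its input and $\mathbf{v}_i[t]$, $t\ge 1$, is its state at the end of the $t$-th iteration. An iterative algorithm requires each process $i$ to perform the following three steps in the $t$-th iteration ($t\ge 1$): (1) transmit $\mathbf{v}_i[t-1]$ on all outgoing edges to the processes in $N_i^+$; (2) receive values (points of $\mathbf{R}^d$) on all incoming edges from the processes in $N_i^-$, forming a multiset $r_i[t]$ of size $|N_i^-|$; (3) update its state as $\mathbf{v}_i[t]=T_i(r_i[t],\mathbf{v}_i[t-1])$, where the transition function $T_i$ is part of the specification of the algorithm. The decision of each process equals its state when the algorithm terminates.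
   Formalization: The formal theorem additionally assumes ε < U − μ; otherwise all admissible inputs already ε-agree, every process can decide its own input at once, and the claim fails (for example on two processes with no edges and f = 0). *)

theory Defs
  imports "HOL-Analysis.Analysis" "Graph_Theory.Pair_Digraph"
begin

text \<open>
  Processes are the vertices of a simple loop-free digraph without parallel arcs
  (\<^locale>\<open>pair_digraph\<close>); states and inputs are points of \<open>real ^ 'd\<close>, so the dimension
  \<open>d\<close> is \<open>CARD('d)\<close>.
\<close>

definition in_nbrs :: "'v pair_pre_digraph \<Rightarrow> 'v \<Rightarrow> 'v set" where
  "in_nbrs G i = {j. (j, i) \<in> parcs G}"

text \<open>
  \<open>transition A i r s\<close> is the state that process \<open>i\<close> computes from the multiset \<open>r\<close> of received
  values and its previous state \<open>s\<close>.  \<open>halt A i t s\<close> tells whether process \<open>i\<close> terminates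
  after \<open>t\<close> iterations when its state is then \<open>s\<close>.  An a priori number \<open>N i\<close> of iterations
  (for instance one computed from the bounds on the inputs) is the special case
  \<open>halt A i t s = (t = N i)\<close>.
\<close>

record ('v, 'd::finite) iterative_algorithm =
  transition :: "'v \<Rightarrow> (real ^ 'd) multiset \<Rightarrow> real ^ 'd \<Rightarrow> real ^ 'd"
  halt :: "'v \<Rightarrow> nat \<Rightarrow> real ^ 'd \<Rightarrow> bool"

text \<open>
  In the following, \<open>v t i\<close> is the state of process \<open>i\<close> at the end of iteration \<open>t\<close>, and
  \<open>m t j i\<close> is the value that \<open>i\<close> receives from its in-neighbor \<open>j\<close> in iteration \<open>t\<close>.
\<close>

definition terminated ::
  "('v, 'd::finite) iterative_algorithm \<Rightarrow> (nat \<Rightarrow> 'v \<Rightarrow> real ^ 'd) \<Rightarrow> nat \<Rightarrow> 'v \<Rightarrow> bool" where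
  "terminated A v t i \<longleftrightarrow> (\<exists>s\<le>t. halt A i s (v s i))"

definition received ::
  "'v pair_pre_digraph \<Rightarrow> (nat \<Rightarrow> 'v \<Rightarrow> 'v \<Rightarrow> real ^ 'd) \<Rightarrow> nat \<Rightarrow> 'v \<Rightarrow> (real ^ 'd) multiset" where
  "received G m t i = image_mset (\<lambda>j. m t j i) (mset_set (in_nbrs G i))"

text \<open>
  Executions with faulty set \<open>F\<close> and inputs \<open>x\<close>.  The messages sent by processes in \<open>F\<close> are
  unconstrained: they may differ from edge to edge and depend on the whole execution.
  A fault-free process that has terminated keeps its state, which is its decision, and
  this is what its out-neighbors that are still running continue to receive.  (If all
  processes terminate after the same number of iterations, this never happens.)
\<close>

definition is_execution ::
  "'v pair_pre_digraph \<Rightarrow> ('v, 'd::finite) iterative_algorithm \<Rightarrow> 'v set \<Rightarrow> ('v \<Rightarrow> real ^ 'd) \<Rightarrow>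
   (nat \<Rightarrow> 'v \<Rightarrow> real ^ 'd) \<Rightarrow> (nat \<Rightarrow> 'v \<Rightarrow> 'v \<Rightarrow> real ^ 'd) \<Rightarrow> bool" where
  "is_execution G A F x v m \<longleftrightarrow>
     (\<forall>i \<in> pverts G - F. v 0 i = x i) \<and>
     (\<forall>t. \<forall>(j, i) \<in> parcs G. j \<notin> F \<longrightarrow> m (Suc t) j i = v t j) \<and>
     (\<forall>t. \<forall>i \<in> pverts G - F.
        v (Suc t) i = (if terminated A v t i then v t i
                       else transition A i (received G m (Suc t) i) (v t i)))"

definition termination_cond ::
  "'v pair_pre_digraph \<Rightarrow> ('v, 'd::finite) iterative_algorithm \<Rightarrow> 'v set \<Rightarrow>
   (nat \<Rightarrow> 'v \<Rightarrow> real ^ 'd) \<Rightarrow> bool" where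
  "termination_cond G A F v \<longleftrightarrow> (\<forall>i \<in> pverts G - F. \<exists>t. terminated A v t i)"

definition validity_cond ::
  "'v pair_pre_digraph \<Rightarrow> 'v set \<Rightarrow> ('v \<Rightarrow> real ^ 'd) \<Rightarrow> (nat \<Rightarrow> 'v \<Rightarrow> real ^ 'd) \<Rightarrow> bool" where
  "validity_cond G F x v \<longleftrightarrow>
     (\<forall>t. \<forall>i \<in> pverts G - F. v t i \<in> convex hull (x ` (pverts G - F)))"

definition eps_agreement_cond ::
  "'v pair_pre_digraph \<Rightarrow> real \<Rightarrow> ('v, 'd::finite) iterative_algorithm \<Rightarrow> 'v set \<Rightarrow>
   (nat \<Rightarrow> 'v \<Rightarrow> real ^ 'd) \<Rightarrow> bool" where
  "eps_agreement_cond G \<epsilon> A F v \<longleftrightarrow>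
     (\<forall>t. (\<forall>i \<in> pverts G - F. terminated A v t i) \<longrightarrow>
        (\<forall>i \<in> pverts G - F. \<forall>j \<in> pverts G - F. \<forall>l. \<bar>v t i $ l - v t j $ l\<bar> \<le> \<epsilon>))"

definition solves_BVC ::
  "'v pair_pre_digraph \<Rightarrow> nat \<Rightarrow> real \<Rightarrow> real \<Rightarrow> real \<Rightarrow>
   ('v, 'd::finite) iterative_algorithm \<Rightarrow> bool" where
  "solves_BVC G f \<mu> U \<epsilon> A \<longleftrightarrow>
     (\<forall>F x v m.
        F \<subseteq> pverts G \<and> card F \<le> f \<and>
        (\<forall>i \<in> pverts G - F. \<forall>l. \<mu> \<le> x i $ l \<and> x i $ l \<le> U) \<and>
        is_execution G A F x v m \<longrightarrow>
        termination_cond G A F v \<and> validity_cond G F x v \<and> eps_agreement_cond G \<epsilon> A F v)"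

definition condition_NC :: "'v pair_pre_digraph \<Rightarrow> nat \<Rightarrow> nat \<Rightarrow> bool" where
  "condition_NC G d f \<longleftrightarrow>
     (\<forall>p V C F.
        1 \<le> p \<and> p \<le> d \<and>
        disjoint_family_on V {0..p} \<and> (\<forall>k \<in> {0..p}. V k \<inter> C = {} \<and> V k \<inter> F = {}) \<and>
        C \<inter> F = {} \<and> (\<Union>k \<in> {0..p}. V k) \<union> C \<union> F = pverts G \<and>
        (\<forall>k \<in> {0..p}. V k \<noteq> {}) \<and> card F \<le> f \<longrightarrow>
        (\<exists>i \<in> {0..p}. \<exists>j \<in> {0..p}. i \<noteq> j \<and>
           (\<exists>w \<in> V j. card (in_nbrs G w \<inter> (V i \<union> C)) \<ge> f + 1)))"

end

theory Submission
  imports Defs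
begin

text \<open>
  If Condition NC fails for a partition, give the processes of \<open>V k\<close> the \<open>k\<close>-th vertex of a
  \<open>p\<close>-simplex of side \<open>U - \<mu>\<close> as input, and let \<open>F\<close> send to each process of \<open>V j\<close> the \<open>j\<close>-th
  vertex.  For \<open>i \<noteq> j\<close>, a process \<open>w\<close> of \<open>V j\<close> cannot exclude that its at most \<open>f\<close>
  in-neighbors in \<open>V i \<union> C\<close> are the faulty ones, so validity keeps \<open>w\<close> in the face opposite to
  the \<open>i\<close>-th vertex.  These faces meet only in the \<open>j\<close>-th vertex, so no \<open>V j\<close> ever moves
  and agreement fails.  Transitions do not depend on the iteration number, so it is enough to
  apply validity to the first iteration of a suitable execution.
\<close>

text \<open>The Boolean remembers whether the process has terminated, so the recursion needs only
  the previous iteration although \<open>terminated\<close> looks at the whole history. Processes in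
  \<open>F\<close> are simulated too; only what they send is replaced by \<open>b\<close>.\<close>

primrec run ::
  "'v pair_pre_digraph \<Rightarrow> ('v, 'd::finite) iterative_algorithm \<Rightarrow> 'v set \<Rightarrow> ('v \<Rightarrow> real ^ 'd) \<Rightarrow>
   ('v \<Rightarrow> 'v \<Rightarrow> real ^ 'd) \<Rightarrow> nat \<Rightarrow> 'v \<Rightarrow> (real ^ 'd) \<times> bool" where
  "run G A F x b 0 = (\<lambda>i. (x i, halt A i 0 (x i)))"
| "run G A F x b (Suc t) = (\<lambda>i.
     let s = fst (run G A F x b t i);
         s' = if snd (run G A F x b t i) then s
              else transition A i
                (image_mset (\<lambda>j. if j \<in> F then b j i else fst (run G A F x b t j))
                  (mset_set (in_nbrs G i))) s
     in (s', snd (run G A F x b t i) \<or> halt A i (Suc t) s'))"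

lemma snd_run: "snd (run G A F x b t i) \<longleftrightarrow> terminated A (\<lambda>t i. fst (run G A F x b t i)) t i"
  by (induction t) (auto simp: terminated_def Let_def le_Suc_eq)

lemma execution_exists:
  "\<exists>v m. is_execution G A F x v m \<and> v 0 = x \<and>
    (\<forall>t i. v (Suc t) i = (if terminated A v t i then v t i
        else transition A i
          (image_mset (\<lambda>j. if j \<in> F then b j i else v t j) (mset_set (in_nbrs G i))) (v t i)))"
proof -
  define v where "v = (\<lambda>t i. fst (run G A F x b t i))"
  \<comment> \<open>Messages of iteration \<open>t\<close> carry states from the end of iteration
    \<open>t - 1\<close>; \<open>is_execution\<close> constrains them only at
    \<open>Suc t\<close>.\<close>
  define m where "m = (\<lambda>t j i. if j \<in> F then b j i else v (t - 1) j)"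
  have v0: "v 0 = x" by (auto simp: v_def)
  have vS: "v (Suc t) i = (if terminated A v t i then v t i
        else transition A i
          (image_mset (\<lambda>j. if j \<in> F then b j i else v t j) (mset_set (in_nbrs G i))) (v t i))" for t i
    using snd_run[of G A F x b t i] by (simp add: v_def Let_def cong: if_cong)
  have "is_execution G A F x v m"
    unfolding is_execution_def received_def vS by (auto simp: v0 m_def cong: if_cong)
  then show ?thesis using v0 vS by blast
qed

text \<open>Any admissible configuration can be an initial one, so validity after one iteration
  constrains \<open>transition\<close> itself. Since \<open>w\<close> does not halt at once, it
  really makes this transition.\<close>

lemma transition_in_convex_hull:
  assumes "solves_BVC G f \<mu> U \<epsilon> A" "F \<subseteq> pverts G" "card F \<le> f"
    and "\<And>i l. i \<in> pverts G - F \<Longrightarrow> \<mu> \<le> x i $ l \<and> x i $ l \<le> U"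
    and "w \<in> pverts G - F" "\<not> halt A w 0 (x w)"
  shows "transition A w
      (image_mset (\<lambda>j. if j \<in> F then b j else x j) (mset_set (in_nbrs G w))) (x w)
    \<in> convex hull (x ` (pverts G - F))"
proof -
  obtain v m where ex: "is_execution G A F x v m" and v0: "v 0 = x"
    and vS: "\<And>t i. v (Suc t) i = (if terminated A v t i then v t i
        else transition A i
          (image_mset (\<lambda>j. if j \<in> F then b j else v t j) (mset_set (in_nbrs G i))) (v t i))"
    using execution_exists[of G A F x "\<lambda>j _. b j"] by blast
  have "validity_cond G F x v"
    using assms(1-4) ex unfolding solves_BVC_def by blast
  then have "v (Suc 0) w \<in> convex hull (x ` (pverts G - F))"
    using assms(5) by (auto simp: validity_cond_def)
  then show ?thesis
    using assms(6) vS[of 0 w] by (simp add: v0 terminated_def cong: if_cong)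
qed

lemma terminated_mono: "terminated A v s i \<Longrightarrow> s \<le> t \<Longrightarrow> terminated A v t i"
  unfolding terminated_def using le_trans by blast

text \<open>Agreement only speaks about times at which all fault-free processes have terminated;
  finiteness supplies one.\<close>

lemma all_terminated:
  assumes "finite (pverts G)" "termination_cond G A F v"
  obtains t where "\<forall>i \<in> pverts G - F. terminated A v t i"
proof -
  obtain T where T: "\<And>i. i \<in> pverts G - F \<Longrightarrow> terminated A v (T i) i"
    using assms(2) unfolding termination_cond_def by metis
  have "terminated A v (Max (T ` (pverts G - F))) i" if "i \<in> pverts G - F" for i
    using T[OF that] by (rule terminated_mono) (use that assms(1) in auto)
  then show thesis using that by blast
qed

lemma simplex_in_cube:
  fixes \<mu> U :: real
  assumes "\<mu> < U" "p \<le> CARD('d::finite)"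
  obtains a :: "nat \<Rightarrow> real ^ 'd" where
    "inj_on a {0..p}" "\<not> affine_dependent (a ` {0..p})"
    "\<And>k l. \<mu> \<le> a k $ l \<and> a k $ l \<le> U"
    "\<And>k. k \<in> {1..p} \<Longrightarrow> \<exists>l. a k $ l - a 0 $ l = U - \<mu>"
proof -
  obtain h :: "nat \<Rightarrow> 'd" where h: "inj_on h {1..p}"
    using inj_on_iff_card_le[of "{1..p}" "UNIV :: 'd set"] assms(2) by auto
  \<comment> \<open>The corner of the cube with all coordinates \<mu>, and its neighbors along
    \<open>p\<close> distinct axes.\<close>
  define a where "a = (\<lambda>k. (\<chi> l. if k \<noteq> 0 \<and> h k = l then U else \<mu>) :: real ^ 'd)"
  define e where "e = (\<lambda>k. axis (h k) (U - \<mu>))"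
  have diff: "- a 0 + a k = e k" if "k \<in> {1..p}" for k
    using that by (auto simp: a_def e_def axis_def vec_eq_iff)
  have "inj_on e {1..p}"
  proof (rule inj_onI)
    fix k k' assume k: "k \<in> {1..p}" "k' \<in> {1..p}" and "e k = e k'"
    then have "h k = h k'" using assms(1) unfolding e_def axis_eq_axis by simp
    then show "k = k'" using h k by (simp add: inj_onD)
  qed
  have "inj_on a {1..p}"
  proof (rule inj_onI)
    fix k k' assume k: "k \<in> {1..p}" "k' \<in> {1..p}" and "a k = a k'"
    then have "e k = e k'" using diff[OF k(1)] diff[OF k(2)] by simp
    then show "k = k'" using \<open>inj_on e {1..p}\<close> k by (simp add: inj_onD)
  qed
  moreover have notin: "a 0 \<notin> a ` {1..p}"
  proof
    assume "a 0 \<in> a ` {1..p}"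
    then obtain k where k: "k \<in> {1..p}" "a 0 = a k" by blast
    then have "e k = 0" using diff[OF k(1)] by simp
    then show False using assms(1) by (simp add: e_def)
  qed
  moreover have split: "{0..p} = insert 0 {1..p}" by auto
  ultimately have inj: "inj_on a {0..p}" by simp
  \<comment> \<open>Affine independence of the vertices is linear independence of the edges at
    \<open>a 0\<close>, which are nonzero and orthogonal.\<close>
  have "independent (e ` {1..p})"
  proof (rule pairwise_orthogonal_independent)
    show "pairwise orthogonal (e ` {1..p})"
      unfolding pairwise_def e_def
      by (auto simp: orthogonal_def inner_axis_axis)
    show "0 \<notin> e ` {1..p}"
      using assms(1) by (auto simp: e_def)
  qed
  moreover have "(\<lambda>y. - a 0 + y) ` a ` {1..p} = e ` {1..p}"
    unfolding image_image by (rule image_cong[OF refl diff])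
  ultimately have "\<not> affine_dependent (a ` {0..p})"
    unfolding split image_insert affine_dependent_iff_dependent[OF notin] by simp
  moreover have "\<mu> \<le> a k $ l \<and> a k $ l \<le> U" for k l
    using assms(1) by (simp add: a_def)
  moreover have "\<exists>l. a k $ l - a 0 $ l = U - \<mu>" if "k \<in> {1..p}" for k
    using that by (intro exI[of _ "h k"]) (simp add: a_def)
  ultimately show thesis using inj that by blast
qed

text \<open>For affinely independent points, intersecting convex hulls amounts to intersecting the
  vertex sets. The faces opposite to the vertices other than \<open>a j\<close> have only
  \<open>a j\<close> as a common vertex.\<close>

lemma Inter_opposite_faces:
  fixes a :: "'k \<Rightarrow> 'a::euclidean_space"
  assumes "\<not> affine_dependent (a ` K)" "inj_on a K" "j \<in> K" "K \<noteq> {j}"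
    and y: "\<And>i. i \<in> K \<Longrightarrow> i \<noteq> j \<Longrightarrow> y \<in> convex hull (a ` (K - {i}))"
  shows "y = a j"
proof -
  define S where "S = (\<lambda>i. a ` (K - {i})) ` (K - {j})"
  have "\<Union>S \<subseteq> a ` K" by (auto simp: S_def)
  then have "\<not> affine_dependent (\<Union>S)"
    using assms(1) affine_dependent_subset by blast
  then have "(\<Inter>T\<in>S. convex hull T) = convex hull (\<Inter>S)"
    by (simp add: convex_hull_Inter)
  moreover have "y \<in> (\<Inter>T\<in>S. convex hull T)"
    using y by (auto simp: S_def)
  moreover have "\<Inter>S \<subseteq> {a j}"
  proof
    fix z assume z: "z \<in> \<Inter>S"
    have face: "z \<in> a ` (K - {i})" if "i \<in> K" "i \<noteq> j" for i
      using z that by (auto simp: S_def)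
    \<comment> \<open>At least one face is needed to know that \<open>z\<close> is a vertex at
      all.\<close>
    obtain i where "i \<in> K" "i \<noteq> j" using assms(3,4) by blast
    with face obtain k where k: "k \<in> K" "z = a k" by blast
    have "k = j"
    proof (rule ccontr)
      assume "k \<noteq> j"
      with face k obtain k' where "k' \<in> K - {k}" "a k = a k'" by blast
      then show False using assms(2) k(1) by (auto dest: inj_onD)
    qed
    then show "z \<in> {a j}" using k by simp
  qed
  ultimately show ?thesis
    using hull_mono[of "\<Inter>S" "{a j}" convex] by auto
qed

text \<open>If \<open>U - \<mu> \<le> \<epsilon>\<close>, halting at once with the input would solve
  the problem in every graph; \<open>\<epsilon> < U - \<mu>\<close> excludes this.\<close>

theorem lemma1:
  fixes G :: "'v pair_pre_digraph" and f :: nat and \<mu> U \<epsilon> :: real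
  assumes "pair_digraph G" and "card (pverts G) \<ge> 2"
    and "0 < \<epsilon>" and "\<epsilon> < U - \<mu>"
    and "\<exists>A :: ('v, 'd::finite) iterative_algorithm. solves_BVC G f \<mu> U \<epsilon> A"
  shows "condition_NC G CARD('d) f"
proof (rule ccontr)
  interpret pair_digraph G by fact
  obtain A :: "('v, 'd) iterative_algorithm" where A: "solves_BVC G f \<mu> U \<epsilon> A"
    using assms(5) by blast
  assume "\<not> condition_NC G CARD('d) f"
  then obtain p V C F where p: "1 \<le> p" "p \<le> CARD('d)"
    and disj: "disjoint_family_on V {0..p}"
    and sep: "\<forall>k\<in>{0..p}. V k \<inter> C = {} \<and> V k \<inter> F = {}" and CF: "C \<inter> F = {}"
    and cover: "(\<Union>k \<in> {0..p}. V k) \<union> C \<union> F = pverts G"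
    and ne: "\<forall>k\<in>{0..p}. V k \<noteq> {}" and F: "card F \<le> f"
    and nc: "\<not> (\<exists>i \<in> {0..p}. \<exists>j \<in> {0..p}. i \<noteq> j \<and>
           (\<exists>w \<in> V j. card (in_nbrs G w \<inter> (V i \<union> C)) \<ge> f + 1))"
    unfolding condition_NC_def not_all not_imp by (elim exE conjE) (rule that)
  have VCF: "V k \<inter> C = {} \<and> V k \<inter> F = {}" if "k \<in> {0..p}" for k
    using sep that by blast
  have few: "card (in_nbrs G w \<inter> (V i \<union> C)) \<le> f"
    if "i \<in> {0..p}" "j \<in> {0..p}" "i \<noteq> j" "w \<in> V j" for i j w
    using nc that by (metis Suc_eq_plus1 not_less_eq_eq)
  have "\<mu> < U" using assms(3,4) by linarith
  then obtain a :: "nat \<Rightarrow> real ^ 'd" where a: "inj_on a {0..p}" "\<not> affine_dependent (a ` {0..p})"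
    and box: "\<And>k l. \<mu> \<le> a k $ l \<and> a k $ l \<le> U"
    and side: "\<And>k. k \<in> {1..p} \<Longrightarrow> \<exists>l. a k $ l - a 0 $ l = U - \<mu>"
    using simplex_in_cube[OF \<open>\<mu> < U\<close> p(2)] by metis
  \<comment> \<open>Outside the sets \<open>V k\<close> this index is unspecified, but
    \<open>box\<close> bounds \<open>a k\<close> for every natural \<open>k\<close>, so the inputs
    in \<open>C\<close> are admissible too.\<close>
  define \<kappa> where "\<kappa> w = (THE k. k \<in> {0..p} \<and> w \<in> V k)" for w
  have \<kappa>: "\<kappa> w = k" if "k \<in> {0..p}" "w \<in> V k" for k w
    using that disj unfolding \<kappa>_def disjoint_family_on_def
    by (intro the_equality) blast+
  define x where "x w = a (\<kappa> w)" for w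
  \<comment> \<open>Each faulty process echoes to every recipient that recipient's own
    input.\<close>
  obtain v m where ex: "is_execution G A F x v m" and v0: "v 0 = x"
    and vS: "\<And>t i. v (Suc t) i = (if terminated A v t i then v t i
        else transition A i
          (image_mset (\<lambda>j. if j \<in> F then x i else v t j) (mset_set (in_nbrs G i))) (v t i))"
    using execution_exists[of G A F x "\<lambda>j i. x i"] by blast
  have sub: "F \<subseteq> pverts G" "C \<subseteq> pverts G" using cover by auto
  have Vsub: "V k \<subseteq> pverts G" if "k \<in> {0..p}" for k
    unfolding cover[symmetric] using that by blast
  have "\<forall>i \<in> pverts G - F. \<forall>l. \<mu> \<le> x i $ l \<and> x i $ l \<le> U"
    using box by (simp add: x_def)
  then have correct: "termination_cond G A F v" "eps_agreement_cond G \<epsilon> A F v"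
    using A ex F sub unfolding solves_BVC_def by blast+

  have stuck: "\<forall>j\<in>{0..p}. \<forall>w\<in>V j. v t w = a j" for t
  proof (induction t)
    case 0
    then show ?case by (auto simp: v0 x_def \<kappa>)
  next
    case (Suc t)
    show ?case
    proof (intro ballI)
      fix j w assume j: "j \<in> {0..p}" and w: "w \<in> V j"
      have vtw: "v t w = a j" and xw: "x w = a j" using Suc j w by (auto simp: x_def \<kappa>)
      show "v (Suc t) w = a j"
      proof (cases "terminated A v t w")
        case True
        then show ?thesis by (simp add: vS vtw)
      next
        case False
        \<comment> \<open>The state at time 0 was already \<open>a j\<close>, so not having
          terminated rules out halting there.\<close>
        then have nohalt: "\<not> halt A w 0 (a j)"
          using xw v0 by (auto simp: terminated_def)
        have "v (Suc t) w \<in> convex hull (a ` ({0..p} - {i}))"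
          if i: "i \<in> {0..p}" "i \<noteq> j" for i
        proof -
          \<comment> \<open>A second scenario that \<open>w\<close> cannot tell apart:
            \<open>F'\<close> is faulty and sends its actual current states, while \<open>F\<close>
            is fault-free with input \<open>a j\<close>. The processes of
            \<open>V i \<union> C\<close> that \<open>w\<close> does not hear also get
            \<open>a j\<close>, so that no fault-free input is \<open>a i\<close>.\<close>
          define F' where "F' = in_nbrs G w \<inter> (V i \<union> C)"
          define x' where "x' u = (if u \<in> V i \<union> C \<union> F then a j else a (\<kappa> u))" for u
          have wni: "w \<notin> V i \<union> C \<union> F"
            using i w VCF[OF j] \<kappa>[OF j w] \<kappa>[OF i(1), of w] by auto
          then have x'w: "x' w = a j" using xw by (simp add: x'_def x_def)
          have F'v: "F' \<subseteq> pverts G" using sub Vsub[OF i(1)] by (auto simp: F'_def)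
          have F'c: "card F' \<le> f" using few i j w by (auto simp: F'_def)
          have x'b: "\<mu> \<le> x' u $ l \<and> x' u $ l \<le> U" for u l using box by (simp add: x'_def)
          have wv: "w \<in> pverts G - F'" using wni Vsub[OF j] w by (auto simp: F'_def)
          \<comment> \<open>The received values agree sender by sender: \<open>F\<close> sends
            \<open>a j\<close> in both scenarios, neighbors in \<open>V i \<union> C\<close> lie in
            \<open>F'\<close>, and every other \<open>V k\<close> is still at \<open>a k\<close> by
            induction.\<close>
          have r: "(if u \<in> F' then v t u else x' u) = (if u \<in> F then x w else v t u)"
            if u: "u \<in> in_nbrs G w" for u
          proof -
            have "u \<in> pverts G" using u by (auto simp: in_nbrs_def in_arcsD1)
            then consider "u \<in> F" | "u \<in> V i \<union> C" "u \<notin> F"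
              | k where "k \<in> {0..p}" "u \<in> V k" "u \<notin> V i \<union> C \<union> F"
              using cover by blast
            then show ?thesis
            proof cases
              case 1
              then show ?thesis using VCF[OF i(1)] CF xw by (auto simp: F'_def x'_def)
            next
              case 2
              then show ?thesis using u by (simp add: F'_def)
            next
              case 3
              then show ?thesis using Suc.IH by (simp add: F'_def x'_def \<kappa>)
            qed
          qed
          have "finite (in_nbrs G w)"
            by (rule finite_subset[OF _ pair_finite_verts]) (auto simp: in_nbrs_def in_arcsD1)
          then have "image_mset (\<lambda>u. if u \<in> F' then v t u else x' u) (mset_set (in_nbrs G w))
              = image_mset (\<lambda>u. if u \<in> F then x w else v t u) (mset_set (in_nbrs G w))"
            using r by (intro image_mset_cong) simp
          then have "v (Suc t) w = transition A w
              (image_mset (\<lambda>u. if u \<in> F' then v t u else x' u) (mset_set (in_nbrs G w))) (x' w)"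
            using False by (simp add: vS vtw x'w)
          then have "v (Suc t) w \<in> convex hull (x' ` (pverts G - F'))"
            using transition_in_convex_hull[where x = x' and b = "v t", OF A F'v F'c x'b wv] nohalt x'w
            by simp
          moreover have "x' ` (pverts G - F') \<subseteq> a ` ({0..p} - {i})"
          proof
            fix y assume "y \<in> x' ` (pverts G - F')"
            then obtain u where u: "u \<in> pverts G" and y: "y = x' u" by blast
            show "y \<in> a ` ({0..p} - {i})"
            proof (cases "u \<in> V i \<union> C \<union> F")
              case True
              then show ?thesis using y i j by (simp add: x'_def)
            next
              case False
              then obtain k where k: "k \<in> {0..p}" "u \<in> V k" using u cover by blast
              then show ?thesis using False y \<kappa>[OF k] by (auto simp: x'_def)
            qed
          qed
          ultimately show ?thesis using hull_mono[of _ _ convex] by blast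
        qed
        moreover have "{0..p} \<noteq> {j}"
          using p(1) by auto
        ultimately show ?thesis
          using Inter_opposite_faces[OF a(2,1) j] by blast
      qed
    qed
  qed

  obtain t where t: "\<forall>i \<in> pverts G - F. terminated A v t i"
    using all_terminated[OF pair_finite_verts correct(1)] by blast
  obtain w0 w1 where w: "w0 \<in> V 0" "w1 \<in> V 1"
    using ne p(1) by (metis all_not_in_conv atLeastAtMost_iff le0)
  then have "w0 \<in> pverts G - F" "w1 \<in> pverts G - F"
    using Vsub[of 0] Vsub[of 1] VCF[of 0] VCF[of 1] p(1) by auto
  then have "\<bar>v t w1 $ l - v t w0 $ l\<bar> \<le> \<epsilon>" for l
    using correct(2) t unfolding eps_agreement_cond_def by blast
  moreover have "v t w0 = a 0" "v t w1 = a 1"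
    using stuck[of t] w p(1) by auto
  \<comment> \<open>In this coordinate the two decisions differ by the full side
    \<open>U - \<mu>\<close>, which exceeds \<epsilon>.\<close>
  moreover obtain l where "a 1 $ l - a 0 $ l = U - \<mu>" using side[of 1] p(1) by auto
  ultimately show False using assms(4) by (metis abs_ge_self leD order_trans)
qed

end
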